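(* Let $m=m(n)$ satisfy $0.98\binom{n}{2}\le m<\binom{n}{2}$, and let $G\sim\mathcal{G}(n,m)$ be a graph on $n$ vertices with exactly $m$ edges chosen uniformly at random. Then asymptotically almost surely (as $n\to\infty$) $G$ has a legal system.
   Context: Let $G=(V,E)$ be a finite simple graph. Subsets of $V$ are identified with elements of $\mathbb{Z}_2^{V}$ (group operation: symmetric difference), and $g$ acts on $S\subseteq V$ by $g(S)=g\,\triangle\, S$. A subset $S\subseteq V$ is a legal state if both $S$ and $V\setminus S$ are non-empty and induce connected subgraphs of $G$. For $v\in V$, a move at $v$ is a set $M_v\subseteq V$ with $v\in M_v$ and $M_v\cap N(v)=\emptyset$. Given moves $\mathcal{M}=\{M_v:v\in V\}$ and $S\subseteq V$, the triple $(G,S,\mathcal{M})$ is a legal system if $g(S)$ is a legal state for every $g\in\langle\mathcal{M}\rangle\le\mathbb{Z}_2^V$. $G$ has a legal system if such $S,\mathcal{M}$ exist. "Asymptotically almost surely" means with probability tending to $1$ as $n\to\infty$. *)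

theory Defs
  imports "HOL-Probability.Probability" "HOL-Algebra.Generated_Groups"
begin

text \<open>A simple graph is given by a vertex set \<open>V\<close> and an edge set \<open>E\<close> of two-element subsets of \<open>V\<close>.\<close>

definition vertex_pairs :: "'a set \<Rightarrow> 'a set set" where
  "vertex_pairs V = {e. e \<subseteq> V \<and> card e = 2}"

definition finite_simple_graph :: "'a set \<Rightarrow> 'a set set \<Rightarrow> bool" where
  "finite_simple_graph V E \<longleftrightarrow> finite V \<and> E \<subseteq> vertex_pairs V"

definition neighbourhood :: "'a set \<Rightarrow> 'a set set \<Rightarrow> 'a \<Rightarrow> 'a set" where
  "neighbourhood V E v = {u \<in> V. {u, v} \<in> E}"

text \<open>Any two vertices of \<open>S\<close> are joined by a walk inside \<open>S\<close>. This holds trivially for the empty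
  set; non-emptiness is demanded separately in \<open>legal_state\<close>.\<close>

definition induces_connected :: "'a set set \<Rightarrow> 'a set \<Rightarrow> bool" where
  "induces_connected E S \<longleftrightarrow>
     (\<forall>u\<in>S. \<forall>v\<in>S. (u, v) \<in> {(x, y). x \<in> S \<and> y \<in> S \<and> {x, y} \<in> E}\<^sup>*)"

definition legal_state :: "'a set \<Rightarrow> 'a set set \<Rightarrow> 'a set \<Rightarrow> bool" where
  "legal_state V E S \<longleftrightarrow> S \<subseteq> V \<and> S \<noteq> {} \<and> V - S \<noteq> {} \<and>
     induces_connected E S \<and> induces_connected E (V - S)"

definition is_move :: "'a set \<Rightarrow> 'a set set \<Rightarrow> 'a \<Rightarrow> 'a set \<Rightarrow> bool" where
  "is_move V E v A \<longleftrightarrow> A \<subseteq> V \<and> v \<in> A \<and> A \<inter> neighbourhood V E v = {}"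

text \<open>The group \<open>\<int>\<^sub>2\<^sup>V\<close>, with a subset of \<open>V\<close> standing for its indicator vector.\<close>

definition symdiff_group :: "'a set \<Rightarrow> 'a set monoid" where
  "symdiff_group V = \<lparr>carrier = Pow V, mult = (\<lambda>A B. sym_diff A B), one = {}\<rparr>"

lemma comm_group_symdiff_group: "comm_group (symdiff_group V)"
proof (rule comm_groupI)
  fix A assume "A \<in> carrier (symdiff_group V)"
  then show "\<exists>B \<in> carrier (symdiff_group V).
      B \<otimes>\<^bsub>symdiff_group V\<^esub> A = \<one>\<^bsub>symdiff_group V\<^esub>"
    by (auto simp: symdiff_group_def)
qed (auto simp: symdiff_group_def)

definition legal_system :: "'a set \<Rightarrow> 'a set set \<Rightarrow> 'a set \<Rightarrow> ('a \<Rightarrow> 'a set) \<Rightarrow> bool" where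
  "legal_system V E S M \<longleftrightarrow> finite_simple_graph V E \<and> S \<subseteq> V \<and> (\<forall>v\<in>V. is_move V E v (M v)) \<and>
     (\<forall>g \<in> generate (symdiff_group V) (M ` V). legal_state V E (sym_diff g S))"

definition has_legal_system :: "'a set \<Rightarrow> 'a set set \<Rightarrow> bool" where
  "has_legal_system V E \<longleftrightarrow> (\<exists>S M. legal_system V E S M)"

text \<open>The uniform random graph \<open>\<G>(n, m)\<close> on the vertex set \<open>{..<n}\<close>, as a distribution on edge sets.
  It is meaningful only for \<open>m \<le> n choose 2\<close>; otherwise there is no graph to choose.\<close>

definition edge_sets :: "nat \<Rightarrow> nat \<Rightarrow> nat set set set" where
  "edge_sets n m = {E. E \<subseteq> vertex_pairs {..<n} \<and> card E = m}"

definition random_graph :: "nat \<Rightarrow> nat \<Rightarrow> nat set set pmf" where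
  "random_graph n m = pmf_of_set (edge_sets n m)"

lemma finite_vertex_pairs: "finite V \<Longrightarrow> finite (vertex_pairs V)"
  by (simp add: vertex_pairs_def)

lemma card_vertex_pairs: "finite V \<Longrightarrow> card (vertex_pairs V) = card V choose 2"
  by (simp add: vertex_pairs_def n_subsets)

lemma finite_edge_sets: "finite (edge_sets n m)"
  by (rule finite_subset[of _ "Pow (vertex_pairs {..<n})"])
    (auto simp: edge_sets_def finite_vertex_pairs)

lemma card_edge_sets: "card (edge_sets n m) = (n choose 2) choose m"
  using n_subsets[OF finite_vertex_pairs[of "{..<n}"], of m]
  by (simp add: edge_sets_def card_vertex_pairs)

lemma set_pmf_random_graph:
  assumes "m \<le> n choose 2"
  shows "set_pmf (random_graph n m) = edge_sets n m"
proof -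
  have "card (edge_sets n m) > 0"
    using assms by (simp add: card_edge_sets)
  then show ?thesis
    unfolding random_graph_def by (intro set_pmf_of_set) (auto simp: card_gt_0_iff)
qed

end

theory Submission
  imports Defs "HOL-Real_Asymp.Real_Asymp"
begin

text \<open>Let \<open>H\<close> be the complement of \<open>G\<close>, and take a maximal matching of \<open>H\<close>. The moves are the
  matching edges, and the singletons at unmatched vertices; the initial state contains exactly one end
  of each matching edge, and this property is preserved by the moves. Unmatched vertices are pairwise
  adjacent in \<open>G\<close>. If \<open>H\<close> has maximum degree at most \<open>d + 1\<close> and more than \<open>4 d (d + 1)\<close> edges, the
  matching has more than \<open>2 d\<close> edges, and then any two vertices of a state that are not adjacent
  in \<open>G\<close> have a common \<open>G\<close>-neighbour in it.

  It remains to bound the maximum degree of \<open>H\<close>, which has \<open>N \<le> n\<^sup>2 / 100\<close> edges. If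
  \<open>N \<le> n powr (2/5)\<close>, then asymptotically almost surely \<open>H\<close> is a matching and \<open>d = 0\<close> works. Otherwise
  the average degree \<open>2 N / n\<close> is at most two fifths of \<open>sqrt N / 2\<close>, and a union bound shows that
  asymptotically almost surely all degrees are at most about \<open>sqrt N / 2\<close>.\<close>

section \<open>Maximal matchings, covers and degrees\<close>

lemma maximal_disjoint_subfamily:
  assumes "finite H" "{} \<notin> H"
  obtains P where "P \<subseteq> H" "disjoint P" "\<And>e. e \<in> H \<Longrightarrow> e \<inter> \<Union>P \<noteq> {}"
proof -
  have "finite {P. P \<subseteq> H \<and> disjoint P}"
    using assms by (intro finite_subset[OF _ finite_Pow_iff[THEN iffD2, OF assms(1)]]) auto
  moreover have "{} \<in> {P. P \<subseteq> H \<and> disjoint P}"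
    by simp
  ultimately obtain P where P: "P \<in> {P. P \<subseteq> H \<and> disjoint P}"
    and max: "\<And>Q. Q \<in> {P. P \<subseteq> H \<and> disjoint P} \<Longrightarrow> P \<subseteq> Q \<Longrightarrow> P = Q"
    by (meson finite_has_maximal2)
  have "e \<inter> \<Union>P \<noteq> {}" if "e \<in> H" for e
  proof
    assume e: "e \<inter> \<Union>P = {}"
    then have "insert e P \<in> {P. P \<subseteq> H \<and> disjoint P}"
      using P that by (auto simp: pairwise_insert disjnt_def)
    then have "e \<in> P"
      using max[of "insert e P"] by auto
    then have "e = {}"
      using e by blast
    then show False
      using that assms by auto
  qed
  then show ?thesis
    using P that by auto
qed

text \<open>Charge each edge to one of its vertices in the cover \<open>C\<close>. With
  \<open>C\<close> the set of ends of a maximal matching, this bounds the size of the matching from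
  below.\<close>

lemma card_le_card_cover_times_degree:
  assumes "finite H" "\<And>e. e \<in> H \<Longrightarrow> e \<inter> C \<noteq> {}" "finite C"
    and "\<And>v. v \<in> C \<Longrightarrow> card {e \<in> H. v \<in> e} \<le> D"
  shows "card H \<le> card C * D"
proof -
  have "card H \<le> card (\<Union>v\<in>C. {e \<in> H. v \<in> e})"
    using assms by (intro card_mono) auto
  also have "\<dots> \<le> (\<Sum>v\<in>C. card {e \<in> H. v \<in> e})"
    by (rule card_UN_le) fact
  also have "\<dots> \<le> card C * D"
    using assms sum_bounded_above[of C "\<lambda>v. card {e \<in> H. v \<in> e}" D] by simp
  finally show ?thesis .
qed

lemma card_neighbours_le:
  assumes "finite H"
  shows "card {w. {v, w} \<in> H} \<le> card {e \<in> H. v \<in> e}"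
proof (rule card_inj_on_le[of "\<lambda>w. {v, w}"])
  show "inj_on (\<lambda>w. {v, w}) {w. {v, w} \<in> H}"
    by (auto simp: inj_on_def doubleton_eq_iff)
qed (use assms in auto)

section \<open>Legal systems from a maximal matching of the complement\<close>

locale complement_matching =
  fixes V :: "'a set" and E P :: "'a set set" and d :: nat
  assumes graph: "finite_simple_graph V E"
    and matching_subset: "P \<subseteq> vertex_pairs V - E"
    and matching_disjoint: "disjoint P"
    and matching_maximal: "\<And>e. e \<in> vertex_pairs V - E \<Longrightarrow> e \<inter> \<Union>P \<noteq> {}"
    and degree_le: "\<And>v. v \<in> V \<Longrightarrow> card {e \<in> vertex_pairs V - E. v \<in> e} \<le> d + 1"
    and matching_large: "2 * d < card P"
begin

lemma finite_V: "finite V"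
  using graph by (simp add: finite_simple_graph_def)

lemma finite_nonedges: "finite (vertex_pairs V - E)"
  using finite_V by (simp add: finite_vertex_pairs)

lemma finite_P: "finite P"
  using finite_subset[OF matching_subset finite_nonedges] .

lemma matching_edge_subset: "e \<in> P \<Longrightarrow> e \<subseteq> V"
  using matching_subset by (auto simp: vertex_pairs_def)

lemma matching_edge_unique: "e \<in> P \<Longrightarrow> f \<in> P \<Longrightarrow> x \<in> e \<Longrightarrow> x \<in> f \<Longrightarrow> e = f"
  using matching_disjoint by (auto simp: pairwise_def disjnt_def)

text \<open>The invariant of the system. It is symmetric under passing to the complement in
  \<open>V\<close>, so proving connectedness once settles both sides of a state. Unmatched vertices
  may lie on either side.\<close>

definition transversal :: "'a set \<Rightarrow> bool" where
  "transversal W \<longleftrightarrow> W \<subseteq> V \<and> (\<forall>e\<in>P. card (e \<inter> W) = 1)"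

lemma transversal_Diff:
  assumes "transversal W"
  shows "transversal (V - W)"
  unfolding transversal_def
proof (intro conjI ballI)
  fix e assume e: "e \<in> P"
  then have 2: "card e = 2" and sub: "e \<subseteq> V"
    using matching_subset by (auto simp: vertex_pairs_def)
  have "e \<inter> (V - W) = e - e \<inter> W"
    using sub by auto
  then show "card (e \<inter> (V - W)) = 1"
    using assms e 2 finite_subset[OF sub finite_V]
    by (simp add: transversal_def card_Diff_subset)
qed auto

lemma transversal_mate:
  assumes "transversal W" "x \<in> W \<inter> \<Union>P"
  obtains y where "{x, y} \<in> P" "y \<notin> W" "y \<in> V"
proof -
  from assms obtain e where e: "e \<in> P" "x \<in> e" "x \<in> W"
    by auto
  then have "card e = 2" "e \<subseteq> V"
    using matching_subset by (auto simp: vertex_pairs_def)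
  then obtain y where y: "e = {x, y}" "x \<noteq> y"
    using e by (auto simp: card_2_iff)
  have "y \<notin> W"
  proof
    assume "y \<in> W"
    then have "e \<inter> W = {x, y}"
      using e y by auto
    moreover have "card (e \<inter> W) = 1"
      using assms e by (auto simp: transversal_def)
    ultimately show False
      using y by simp
  qed
  then show ?thesis
    using e y \<open>e \<subseteq> V\<close> that by auto
qed

lemma card_transversal:
  assumes "transversal W"
  shows "card (W \<inter> \<Union>P) = card P"
proof -
  have "W \<inter> \<Union>P = (\<Union>e\<in>P. e \<inter> W)"
    by auto
  also have "card \<dots> = (\<Sum>e\<in>P. card (e \<inter> W))"
    using finite_P matching_disjoint finite_subset[OF matching_edge_subset finite_V]
    by (intro card_UN_disjoint) (auto simp: pairwise_def disjnt_def)
  also have "\<dots> = card P"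
    using assms by (simp add: transversal_def)
  finally show ?thesis .
qed

lemma card_neighbours_le_degree:
  "v \<in> V \<Longrightarrow> card {w. {v, w} \<in> vertex_pairs V - E} \<le> d + 1"
  using card_neighbours_le[OF finite_nonedges] degree_le order_trans by blast

lemma finite_neighbours: "finite {w. {v, w} \<in> vertex_pairs V - E}"
  by (rule finite_subset[OF _ finite_V]) (auto simp: vertex_pairs_def)

text \<open>Together \<open>x\<close> and \<open>y\<close> have at most \<open>2 * d + 2\<close>
  neighbours in the complement graph, and two of these lie outside the matched part of
  \<open>W\<close>. At most \<open>2 * d\<close> of the \<open>card P\<close> matched vertices of
  \<open>W\<close> are thus ruled out, which is where the bound \<open>2 * d < card P\<close> comes
  from.\<close>

lemma transversal_common_neighbour:
  assumes W: "transversal W" and x: "x \<in> W" and y: "y \<in> W \<inter> \<Union>P"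
    and xy: "{x, y} \<in> vertex_pairs V - E"
  obtains z where "z \<in> W" "{x, z} \<in> E" "{z, y} \<in> E"
proof -
  define N where "N v = {w. {v, w} \<in> vertex_pairs V - E}" for v
  have V: "x \<in> V" "y \<in> V"
    using W x y by (auto simp: transversal_def)
  obtain y' where y': "{y, y'} \<in> P" "y' \<notin> W"
    using transversal_mate[OF W y] .
  have fin: "finite (N x \<union> N y)"
    unfolding N_def by (simp add: finite_neighbours del: mem_Collect_eq Diff_iff)
  have "card (N x \<union> N y) \<le> card (N x) + card (N y)"
    by (rule card_Un_le)
  also have "\<dots> \<le> 2 * d + 2"
    using card_neighbours_le_degree[OF V(1)] card_neighbours_le_degree[OF V(2)]
    unfolding N_def by linarith
  finally have N2: "card (N x \<union> N y) \<le> 2 * d + 2" .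
  \<comment> \<open>Besides the mate \<open>y'\<close>, a second \<open>H\<close>-neighbour of \<open>x\<close> or \<open>y\<close> lies outside the matched part of \<open>W\<close>:
    the mate of \<open>x\<close>, or \<open>x\<close> itself if it is unmatched.\<close>
  obtain q where q: "q \<in> N x \<union> N y" "q \<notin> W \<inter> \<Union>P" "q \<noteq> y'"
  proof (cases "x \<in> \<Union>P")
    case True
    then obtain x' where x': "{x, x'} \<in> P" "x' \<notin> W"
      using transversal_mate[OF W, of x] x by auto
    have "x' \<noteq> y'"
    proof
      assume "x' = y'"
      then have "{x, x'} = {y, x'}"
        using matching_edge_unique[OF x'(1) y'(1), of x'] by simp
      then have "x = y"
        by (auto simp: doubleton_eq_iff)
      then show False
        using xy by (auto simp: vertex_pairs_def)
    qed
    then show ?thesis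
      using that[of x'] x' matching_subset by (auto simp: N_def)
  next
    case False
    then show ?thesis
      using that[of x] xy x y' by (auto simp: N_def insert_commute)
  qed
  have "y' \<in> N y"
    using y' matching_subset by (auto simp: N_def)
  have "card (W \<inter> \<Union>P \<inter> (N x \<union> N y)) \<le> card (N x \<union> N y - {q, y'})"
    using q y' fin by (intro card_mono) auto
  also have "\<dots> = card (N x \<union> N y) - 2"
    using q \<open>y' \<in> N y\<close> by (subst card_Diff_subset) auto
  also have "\<dots> < card (W \<inter> \<Union>P)"
    using N2 matching_large card_transversal[OF W] by simp
  finally have "W \<inter> \<Union>P \<inter> (N x \<union> N y) \<noteq> W \<inter> \<Union>P"
    by auto
  then obtain z where z: "z \<in> W" "z \<notin> N x" "z \<notin> N y"
    by auto
  \<comment> \<open>The nonedge \<open>{x, y}\<close> puts \<open>y\<close> into \<open>N x\<close>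
    and \<open>x\<close> into \<open>N y\<close>, so avoiding both sets also makes \<open>z\<close>
    distinct from \<open>x\<close> and \<open>y\<close>. Only then does being outside
    \<open>N x\<close> and \<open>N y\<close> mean adjacency in \<open>E\<close>.\<close>
  have "z \<noteq> x" "z \<noteq> y"
    using z xy by (auto simp: N_def insert_commute)
  moreover have "z \<in> V"
    using z W by (auto simp: transversal_def)
  ultimately have "{x, z} \<in> E" "{z, y} \<in> E"
    using z V by (auto simp: N_def vertex_pairs_def insert_commute)
  with z show ?thesis
    using that by blast
qed

lemma transversal_connected:
  assumes W: "transversal W"
  shows "induces_connected E W"
  unfolding induces_connected_def
proof (intro ballI)
  fix x y assume x: "x \<in> W" and y: "y \<in> W"
  let ?R = "{(x, y). x \<in> W \<and> y \<in> W \<and> {x, y} \<in> E}"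
  consider "x = y" | "{x, y} \<in> E" | "{x, y} \<in> vertex_pairs V - E"
    using x y W by (cases "x = y") (auto simp: vertex_pairs_def transversal_def)
  then show "(x, y) \<in> ?R\<^sup>*"
  proof cases
    case 3
    \<comment> \<open>By maximality a nonadjacent pair contains a matched vertex; the two cases put
      that vertex into the second role of the previous lemma.\<close>
    then consider "x \<in> \<Union>P" | "y \<in> \<Union>P"
      using matching_maximal by blast
    then obtain z where "z \<in> W" "{x, z} \<in> E" "{z, y} \<in> E"
    proof cases
      case 1
      then obtain z where "z \<in> W" "{y, z} \<in> E" "{z, x} \<in> E"
        using transversal_common_neighbour[OF W y, of x] x 3 by (auto simp: insert_commute)
      then show ?thesis
        using that by (auto simp: insert_commute)
    next
      case 2
      then show ?thesis
        using transversal_common_neighbour[OF W x, of y] y 3 that by auto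
    qed
    then have "(x, z) \<in> ?R" "(z, y) \<in> ?R"
      using x y by auto
    then show ?thesis
      by (meson r_into_rtrancl rtrancl_trans)
  qed (use x y in auto)
qed

lemma transversal_legal_state:
  assumes "transversal W"
  shows "legal_state V E W"
proof -
  have "card P \<noteq> 0"
    using matching_large by auto
  then have "U \<noteq> {}" if "transversal U" for U
    using card_transversal[OF that] by auto
  moreover have "W \<subseteq> V"
    using assms by (simp add: transversal_def)
  ultimately show ?thesis
    unfolding legal_state_def using assms transversal_Diff transversal_connected by blast
qed

text \<open>As \<open>P\<close> is disjoint, the union ranges over at most one edge. The form with
  \<open>insert\<close> treats matched and unmatched vertices uniformly, without choosing a
  mate.\<close>

definition matching_move :: "'a \<Rightarrow> 'a set" where
  "matching_move v = insert v (\<Union>{e \<in> P. v \<in> e})"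

lemma matching_move_cases:
  obtains "matching_move v = {v}" "v \<notin> \<Union>P" | "matching_move v \<in> P"
proof (cases "v \<in> \<Union>P")
  case True
  then obtain e where e: "e \<in> P" "v \<in> e"
    by auto
  then have "{e \<in> P. v \<in> e} = {e}"
    using matching_edge_unique by auto
  then have "matching_move v = e"
    using e by (auto simp: matching_move_def)
  then show ?thesis
    using that e by auto
next
  case False
  then have "matching_move v = {v}"
    by (auto simp: matching_move_def)
  then show ?thesis
    using that False by auto
qed

lemma is_move_matching_move:
  assumes "v \<in> V"
  shows "is_move V E v (matching_move v)"
proof -
  have v: "v \<in> matching_move v"
    by (simp add: matching_move_def)
  have loop: "{v} \<notin> E"
    using graph by (auto simp: finite_simple_graph_def vertex_pairs_def)
  show ?thesis
  proof (cases v rule: matching_move_cases)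
    case 1
    then show ?thesis
      using assms loop by (auto simp: is_move_def neighbourhood_def)
  next
    case 2
    then have card2: "card (matching_move v) = 2" and "matching_move v \<subseteq> V" "matching_move v \<notin> E"
      using matching_subset by (auto simp: vertex_pairs_def)
    obtain a b where "matching_move v = {a, b}"
      using card2 by (auto simp: card_2_iff)
    then have "matching_move v = {v, if v = a then b else a}"
      using v by auto
    then obtain w where "matching_move v = {v, w}"
      by blast
    then show ?thesis
      using v loop \<open>matching_move v \<subseteq> V\<close> \<open>matching_move v \<notin> E\<close>
      by (auto simp: is_move_def neighbourhood_def insert_commute)
  qed
qed

text \<open>The condition says that the indicator of \<open>g\<close> is constant on every matching
  edge. This is linear over the field with two elements, so it passes from the generators to the
  whole group.\<close>

lemma generated_saturated:
  assumes "g \<in> generate (symdiff_group V) (matching_move ` V)"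
  shows "g \<subseteq> V \<and> (\<forall>e\<in>P. e \<inter> g = {} \<or> e \<subseteq> g)"
proof -
  have move: "h \<subseteq> V \<and> (\<forall>e\<in>P. e \<inter> h = {} \<or> e \<subseteq> h)" if h: "h \<in> matching_move ` V" for h
  proof -
    from h obtain v where v: "v \<in> V" "h = matching_move v"
      by auto
    show ?thesis
    proof (cases v rule: matching_move_cases)
      case 1
      then show ?thesis
        using v by auto
    next
      case 2
      have "e \<inter> h = {} \<or> e \<subseteq> h" if "e \<in> P" for e
        using matching_edge_unique[OF that 2] v(2) by blast
      then show ?thesis
        using matching_edge_subset[OF 2] v(2) by blast
    qed
  qed
  interpret comm_group "symdiff_group V"
    by (rule comm_group_symdiff_group)
  \<comment> \<open>Inverses of generators form a separate case of \<open>generate\<close>; here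
    every element is its own inverse.\<close>
  have inv_eq: "inv\<^bsub>symdiff_group V\<^esub> h = h" if "h \<subseteq> V" for h
    using that by (intro inv_equality) (auto simp: symdiff_group_def)
  from assms show ?thesis
  proof induction
    case one
    then show ?case
      by (simp add: symdiff_group_def)
  next
    case (incl h)
    then show ?case
      by (rule move)
  next
    case (inv h)
    then show ?case
      using move[of h] inv_eq by simp
  next
    case (eng h1 h2)
    have "e \<inter> sym_diff h1 h2 = {} \<or> e \<subseteq> sym_diff h1 h2" if "e \<in> P" for e
    proof -
      have "e \<inter> h1 = {} \<or> e \<subseteq> h1" "e \<inter> h2 = {} \<or> e \<subseteq> h2"
        using eng.IH that by auto
      then show ?thesis
        by auto
    qed
    moreover have "sym_diff h1 h2 \<subseteq> V"
      using eng.IH by auto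
    ultimately show ?case
      by (simp add: symdiff_group_def)
  qed
qed

lemma has_legal_system: "has_legal_system V E"
proof -
  define S where "S = (\<lambda>e. SOME x. x \<in> e) ` P"
  have some: "(SOME x. x \<in> e) \<in> e" if "e \<in> P" for e
  proof -
    have "card e = 2"
      using that matching_subset by (auto simp: vertex_pairs_def)
    then show ?thesis
      by (intro some_in_eq[THEN iffD2]) auto
  qed
  have "e \<inter> S = {SOME x. x \<in> e}" if "e \<in> P" for e
    using that some matching_edge_unique unfolding S_def by blast
  then have S: "card (e \<inter> S) = 1" if "e \<in> P" for e
    using that by simp
  have SV: "S \<subseteq> V"
    using some matching_edge_subset by (auto simp: S_def)
  then have tS: "transversal S"
    using S by (simp add: transversal_def)
  have "transversal (sym_diff g S)"
    if "g \<in> generate (symdiff_group V) (matching_move ` V)" for g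
  proof -
    have g: "g \<subseteq> V" "\<And>e. e \<in> P \<Longrightarrow> e \<inter> g = {} \<or> e \<subseteq> g"
      using generated_saturated[OF that] by auto
    have "card (e \<inter> sym_diff g S) = 1" if e: "e \<in> P" for e
      using g(2)[OF e]
    proof
      assume "e \<inter> g = {}"
      then have "e \<inter> sym_diff g S = e \<inter> S"
        by auto
      then show ?thesis
        using S e by simp
    next
      assume "e \<subseteq> g"
      \<comment> \<open>On a matching edge inside \<open>g\<close>, the action of \<open>g\<close>
        swaps the chosen and the unchosen end, just as complementation does.\<close>
      then have "e \<inter> sym_diff g S = e \<inter> (V - S)"
        using matching_edge_subset[OF e] by auto
      then show ?thesis
        using transversal_Diff[OF tS] e by (simp add: transversal_def)
    qed
    then show ?thesis
      using g SV by (auto simp: transversal_def)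
  qed
  then have "legal_system V E S matching_move"
    unfolding legal_system_def
    using graph SV is_move_matching_move transversal_legal_state by blast
  then show ?thesis
    unfolding has_legal_system_def by blast
qed

end

text \<open>The \<open>2 * card P\<close> ends of a maximal matching meet every nonedge, and each
  lies on at most \<open>d + 1\<close> of them. Hence there are at most
  \<open>2 * card P * (d + 1)\<close> nonedges, and the lower bound on their number forces
  \<open>2 * d < card P\<close>.\<close>

lemma has_legal_system_if_complement_degree_le:
  assumes graph: "finite_simple_graph V E"
    and deg: "\<And>v. v \<in> V \<Longrightarrow> card {e \<in> vertex_pairs V - E. v \<in> e} \<le> d + 1"
    and card: "4 * d * (d + 1) < card (vertex_pairs V - E)"
  shows "has_legal_system V E"
proof -
  let ?H = "vertex_pairs V - E"
  have V: "finite V"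
    using graph by (simp add: finite_simple_graph_def)
  then have fin: "finite ?H"
    by (simp add: finite_vertex_pairs)
  have ne: "{} \<notin> ?H"
    by (simp add: vertex_pairs_def)
  obtain P where P: "P \<subseteq> ?H" "disjoint P" "\<And>e. e \<in> ?H \<Longrightarrow> e \<inter> \<Union>P \<noteq> {}"
    by (rule maximal_disjoint_subfamily[OF fin ne]) blast
  have PV: "\<Union>P \<subseteq> V"
    using P(1) by (auto simp: vertex_pairs_def)
  have "card ?H \<le> card (\<Union>P) * (d + 1)"
    using fin P(3) finite_subset[OF PV V] deg PV by (intro card_le_card_cover_times_degree) auto
  also have "\<dots> \<le> 2 * card P * (d + 1)"
  proof (rule mult_right_mono)
    have "card (\<Union>P) \<le> (\<Sum>e\<in>P. card e)"
      by (rule card_Union_le_sum_card)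
    also have "\<dots> = 2 * card P"
      using P(1) by (subst sum.cong[of P P card "\<lambda>_. 2"]) (auto simp: vertex_pairs_def)
    finally show "card (\<Union>P) \<le> 2 * card P" .
  qed simp
  finally have "4 * d * (d + 1) < 2 * card P * (d + 1)"
    using card by linarith
  then have "2 * d < card P"
    by (simp only: mult_less_cancel2) simp
  then interpret complement_matching V E P d
    using graph P deg by unfold_locales auto
  show ?thesis
    by (rule has_legal_system)
qed

section \<open>Counting edge sets that miss many pairs of a given family\<close>

lemma card_subsets_avoiding:
  assumes "finite X" "F \<subseteq> X"
  shows "card {E. E \<subseteq> X \<and> card E = m \<and> F \<inter> E = {}} = (card X - card F) choose m"
proof -
  have "{E. E \<subseteq> X \<and> card E = m \<and> F \<inter> E = {}} = {E. E \<subseteq> X - F \<and> card E = m}"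
    by auto
  then show ?thesis
    using assms by (simp add: n_subsets card_Diff_subset finite_subset)
qed

text \<open>A Markov inequality for the number of \<open>s\<close>-subsets of \<open>A - E\<close>.\<close>

lemma card_subsets_missing_many_le:
  assumes X: "finite X" "A \<subseteq> X"
  shows "card {E. E \<subseteq> X \<and> card E = m \<and> t \<le> card (A - E)} * (t choose s)
    \<le> (card A choose s) * ((card X - s) choose m)"
proof -
  let ?B = "{E. E \<subseteq> X \<and> card E = m \<and> t \<le> card (A - E)}"
  let ?X = "{E. E \<subseteq> X \<and> card E = m}"
  let ?F = "{F. F \<subseteq> A \<and> card F = s}"
  have A: "finite A"
    using X finite_subset by blast
  have finX: "finite ?X"
    using X by (intro finite_subset[of ?X "Pow X"]) auto
  have finF: "finite ?F"
    using A by (intro finite_subset[of ?F "Pow A"]) auto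
  have "card ?B * (t choose s) = (\<Sum>E\<in>?B. t choose s)"
    by simp
  also have "\<dots> \<le> (\<Sum>E\<in>?B. card (A - E) choose s)"
    by (intro sum_mono binomial_right_mono) auto
  also have "\<dots> \<le> (\<Sum>E\<in>?X. card (A - E) choose s)"
    using finX by (intro sum_mono2) auto
  also have "\<dots> = (\<Sum>E\<in>?X. card {F \<in> ?F. F \<inter> E = {}})"
  proof (intro sum.cong refl)
    fix E
    have "{F \<in> ?F. F \<inter> E = {}} = {F. F \<subseteq> A - E \<and> card F = s}"
      by auto
    then show "(card (A - E) choose s) = card {F \<in> ?F. F \<inter> E = {}}"
      using A by (simp add: n_subsets)
  qed
  \<comment> \<open>Double counting of the pairs \<open>(E, F)\<close> with \<open>F\<close>
    disjoint from \<open>E\<close>.\<close>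
  also have "\<dots> = (\<Sum>F\<in>?F. card {E \<in> ?X. F \<inter> E = {}})"
    by (rule sum_multicount_gen[where R = "\<lambda>E F. F \<inter> E = {}", OF finX finF]) simp
  also have "\<dots> = (\<Sum>F\<in>?F. (card X - s) choose m)"
  proof (intro sum.cong refl)
    fix F assume F: "F \<in> ?F"
    have "{E \<in> ?X. F \<inter> E = {}} = {E. E \<subseteq> X \<and> card E = m \<and> F \<inter> E = {}}"
      by auto
    then show "card {E \<in> ?X. F \<inter> E = {}} = ((card X - s) choose m)"
      using card_subsets_avoiding[OF X(1), of F m] F X(2) by auto
  qed
  also have "\<dots> = (card A choose s) * ((card X - s) choose m)"
    using A by (simp add: n_subsets)
  finally show ?thesis .
qed

text \<open>Up to normalisation, the left side is the probability that a random
  \<open>m\<close>-subset of a \<open>k\<close>-set misses \<open>s\<close> given points.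
  Conditioned on the earlier misses, each further point is missed with probability at most
  \<open>(k - m) / k\<close>.\<close>

lemma binomial_diff_le_power:
  assumes "m \<le> k" "s \<le> k" "0 < k"
  shows "real ((k - s) choose m) \<le> (real (k - m) / real k) ^ s * real (k choose m)"
  using assms(2)
proof (induction s)
  case (Suc s)
  let ?q = "real (k - m) / real k"
  have ks: "k - s = Suc (k - Suc s)"
    using Suc by simp
  have le: "real ((k - Suc s) choose m) \<le> ?q * real ((k - s) choose m)"
  proof (cases "m \<le> k - s")
    case True
    have "real (k - s - m) * real ((k - s) choose m) = real (k - s) * real ((k - Suc s) choose m)"
    proof -
      have "(k - s - m) * ((k - s) choose m) = (k - s) * ((k - Suc s) choose m)"
        using binomial_absorb_comp[of "k - s" m] by simp
      then show ?thesis
        by (simp only: of_nat_mult[symmetric])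
    qed
    then have "real ((k - Suc s) choose m) = real (k - s - m) / real (k - s) * real ((k - s) choose m)"
      using ks by (simp add: field_simps)
    also have "real (k - s - m) / real (k - s) \<le> ?q"
    proof -
      \<comment> \<open>The right side exceeds the left by \<open>m * s\<close>.\<close>
      have "real (k - s - m) * real k \<le> real (k - m) * real (k - s)"
        using True assms Suc by (simp add: of_nat_diff algebra_simps)
      then show ?thesis
        using ks assms by (simp add: divide_simps del: of_nat_diff)
    qed
    finally show ?thesis
      by (simp add: mult_right_mono)
  next
    case False
    then show ?thesis
      by (simp add: binomial_eq_0)
  qed
  also have "\<dots> \<le> ?q * (?q ^ s * real (k choose m))"
    using Suc by (intro mult_left_mono) auto
  finally show ?case
    by (simp add: mult.assoc)
qed simp

text \<open>A division-free form of the bound \<open>(a / (t - s + 1)) ^ s\<close> on the quotient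
  of \<open>a choose s\<close> by \<open>t choose s\<close>. Each of the \<open>s\<close> factors of
  the falling factorial of \<open>t\<close> is at least \<open>t - s + 1\<close>, while that of
  \<open>a\<close> is at most \<open>a ^ s\<close>.\<close>

lemma power_mult_binomial_le:
  assumes "s \<le> t"
  shows "(real t - real s + 1) ^ s * real (a choose s) \<le> real a ^ s * real (t choose s)"
proof -
  have "(real t - real s + 1) ^ s \<le> real (t choose s) * fact s"
  proof -
    have "(real t - real s + 1) ^ s = (\<Prod>i = 0..<s. real t - real s + 1)"
      by simp
    also have "\<dots> \<le> (\<Prod>i = 0..<s. real t - real i)"
      using assms by (intro prod_mono) auto
    also have "\<dots> = real (t choose s) * fact s"
      by (simp add: binomial_gbinomial gbinomial_prod_rev)
    finally show ?thesis .
  qed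
  then have "(real t - real s + 1) ^ s * real (a choose s) \<le> real (t choose s) * fact s * real (a choose s)"
    by (rule mult_right_mono) simp
  also have "\<dots> = real (t choose s) * real (fact s * (a choose s))"
    by simp
  also have "\<dots> \<le> real (t choose s) * real (a ^ s)"
    by (intro mult_left_mono of_nat_mono binomial_fact_pow[of a s, unfolded mult.commute[of "a choose s"]]) simp
  finally show ?thesis
    by (simp add: mult.commute)
qed

section \<open>Degrees in the complement of the random graph\<close>

lemma card_star:
  assumes "finite V" "v \<in> V"
  shows "card {e \<in> vertex_pairs V. v \<in> e} = card V - 1"
proof -
  have "{e \<in> vertex_pairs V. v \<in> e} = (\<lambda>w. {v, w}) ` (V - {v})"
    using assms by (auto simp: vertex_pairs_def card_2_iff)
  moreover have "inj_on (\<lambda>w. {v, w}) (V - {v})"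
    by (auto simp: inj_on_def doubleton_eq_iff)
  ultimately show ?thesis
    using assms by (simp add: card_image)
qed

text \<open>The Markov bound applied to the star at \<open>v\<close>, which has \<open>n - 1\<close>
  pairs. Multiplying \<open>n - 1\<close> by the density of missing pairs gives
  \<open>2 * ((n choose 2) - m) / n\<close>, the average degree of the complement. The parameter
  \<open>s\<close> is left free and is chosen differently in the two regimes.\<close>

lemma prob_degree_ge:
  assumes n: "2 \<le> n" and m: "m \<le> n choose 2" and v: "v < n" and s: "s \<le> t" "s < n"
  shows "measure_pmf.prob (random_graph n m) {E. t \<le> card {e \<in> vertex_pairs {..<n} - E. v \<in> e}}
    \<le> (2 * real ((n choose 2) - m) / real n / (real t - real s + 1)) ^ s"
proof -
  let ?X = "vertex_pairs {..<n}" and ?K = "n choose 2"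
  let ?A = "{e \<in> ?X. v \<in> e}"
  let ?B = "{E. E \<subseteq> ?X \<and> card E = m \<and> t \<le> card (?A - E)}"
  have X: "finite ?X" "card ?X = ?K"
    by (simp_all add: finite_vertex_pairs card_vertex_pairs)
  have A: "card ?A = n - 1"
    using card_star[of "{..<n}" v] v by simp
  have "card ?A \<le> card ?X"
    using X by (intro card_mono) auto
  then have sK: "s \<le> ?K" and K: "0 < ?K"
    using A X s n by auto
  have Kn: "real ?K = real n * (real n - 1) / 2"
    using n by (simp add: choose_two real_of_nat_div of_nat_diff)
  have Km: "0 < ?K choose m"
    using m by simp
  have pos: "0 < t choose s" "0 < real t - real s + 1"
    using s by auto
  have ne: "edge_sets n m \<noteq> {}"
    using Km card_edge_sets[of n m] by (metis card.empty less_irrefl)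
  have frac: "b / e \<le> c / a" if "a * b \<le> c * e" "0 < a" "0 < e" for a b c e :: real
    using that by (simp add: field_simps)
  have set: "edge_sets n m \<inter> {E. t \<le> card {e \<in> ?X - E. v \<in> e}} = ?B"
  proof -
    have "{e \<in> ?X - E. v \<in> e} = ?A - E" for E
      by auto
    then show ?thesis
      by (auto simp: edge_sets_def)
  qed
  have "real (card ?B) * real (t choose s) \<le> real ((n - 1) choose s) * real ((?K - s) choose m)"
    using card_subsets_missing_many_le[OF X(1), of ?A m t s] A X
    by (metis (no_types, lifting) mem_Collect_eq of_nat_le_iff of_nat_mult subsetI)
  also have "\<dots> \<le> real ((n - 1) choose s) * ((real (?K - m) / real ?K) ^ s * real (?K choose m))"
    using m sK K by (intro mult_left_mono binomial_diff_le_power) auto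
  finally have "(real t - real s + 1) ^ s * (real (card ?B) * real (t choose s))
      \<le> (real t - real s + 1) ^ s * (real ((n - 1) choose s) * ((real (?K - m) / real ?K) ^ s * real (?K choose m)))"
    using pos by (intro mult_left_mono) auto
  also have "\<dots> = ((real t - real s + 1) ^ s * real ((n - 1) choose s)) * ((real (?K - m) / real ?K) ^ s * real (?K choose m))"
    by (simp add: mult_ac)
  also have "\<dots> \<le> (real (n - 1) ^ s * real (t choose s)) * ((real (?K - m) / real ?K) ^ s * real (?K choose m))"
    using s by (intro mult_right_mono power_mult_binomial_le) auto
  finally have "real (t choose s) * ((real t - real s + 1) ^ s * real (card ?B))
      \<le> real (t choose s) * ((real (n - 1) * (real (?K - m) / real ?K)) ^ s * real (?K choose m))"
    by (simp only: power_mult_distrib mult_ac)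
  then have "(real t - real s + 1) ^ s * real (card ?B)
      \<le> (real (n - 1) * (real (?K - m) / real ?K)) ^ s * real (?K choose m)"
    by (rule mult_left_le_imp_le) (use pos in simp)
  also have "real (n - 1) * (real (?K - m) / real ?K) = 2 * real (?K - m) / real n"
    unfolding Kn using n by (simp add: of_nat_diff field_simps)
  finally have "real (card ?B) / real (?K choose m) \<le> (2 * real (?K - m) / real n) ^ s / (real t - real s + 1) ^ s"
    by (rule frac) (use pos(2) Km in auto)
  moreover have "measure_pmf.prob (random_graph n m) {E. t \<le> card {e \<in> ?X - E. v \<in> e}}
      = real (card ?B) / real (?K choose m)"
    unfolding random_graph_def measure_pmf_of_set[OF ne finite_edge_sets] set card_edge_sets ..
  ultimately show ?thesis
    by (simp only: power_divide)
qed

text \<open>A union bound over the vertices. On the support of the random graph the number of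
  nonedges is exactly \<open>(n choose 2) - m\<close>, so the degree criterion can fail only through
  a vertex of complement degree at least \<open>d + 2\<close>.\<close>

lemma prob_no_legal_system_le:
  assumes n: "2 \<le> n" and m: "m \<le> n choose 2" and s: "s \<le> d + 2" "s < n"
    and N: "4 * d * (d + 1) < (n choose 2) - m"
  shows "measure_pmf.prob (random_graph n m) {E. \<not> has_legal_system {..<n} E}
    \<le> real n * (2 * real ((n choose 2) - m) / real n / (real (d + 2) - real s + 1)) ^ s"
proof -
  let ?p = "measure_pmf.prob (random_graph n m)" and ?X = "vertex_pairs {..<n}"
  let ?B = "\<lambda>v. {E. d + 2 \<le> card {e \<in> ?X - E. v \<in> e}}"
  have "?p {E. \<not> has_legal_system {..<n} E} \<le> ?p (\<Union>v<n. ?B v)"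
  proof (rule measure_pmf.finite_measure_mono_AE)
    show "AE E in random_graph n m. E \<in> {E. \<not> has_legal_system {..<n} E} \<longrightarrow> E \<in> (\<Union>v<n. ?B v)"
    proof (rule AE_pmfI, intro impI)
      fix E assume "E \<in> set_pmf (random_graph n m)" and no: "E \<in> {E. \<not> has_legal_system {..<n} E}"
      then have E: "E \<subseteq> ?X" "card E = m"
        using set_pmf_random_graph[OF m] by (auto simp: edge_sets_def)
      then have "card (?X - E) = (n choose 2) - m"
        using finite_vertex_pairs[of "{..<n}"]
        by (simp add: card_Diff_subset finite_subset card_vertex_pairs)
      then have "\<not> (\<forall>v\<in>{..<n}. card {e \<in> ?X - E. v \<in> e} \<le> d + 1)"
        using has_legal_system_if_complement_degree_le[of "{..<n}" E d] N no E(1)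
        unfolding finite_simple_graph_def by auto
      then show "E \<in> (\<Union>v<n. ?B v)"
        by (simp add: not_le Suc_le_eq)
    qed
  qed simp
  also have "\<dots> \<le> (\<Sum>v<n. ?p (?B v))"
    by (rule measure_UNION_le) auto
  also have "\<dots> \<le> (\<Sum>v<n. (2 * real ((n choose 2) - m) / real n / (real (d + 2) - real s + 1)) ^ s)"
    using n m s by (intro sum_mono prob_degree_ge) auto
  finally show ?thesis
    by simp
qed

section \<open>The sparse and the dense regime of the complement\<close>

lemma prob_no_legal_system_sparse:
  assumes n: "3 \<le> n" and m: "m < n choose 2" and N: "real ((n choose 2) - m) \<le> real n powr (2/5)"
  shows "measure_pmf.prob (random_graph n m) {E. \<not> has_legal_system {..<n} E} \<le> 4 * real n powr (-1/5)"
proof -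
  let ?N = "real ((n choose 2) - m)"
  have "measure_pmf.prob (random_graph n m) {E. \<not> has_legal_system {..<n} E} \<le> real n * (2 * ?N / real n) ^ 2"
    \<comment> \<open>With \<open>d = 0\<close> and \<open>s = 2\<close> the bad event is a vertex
      of complement degree at least 2, and the denominator \<open>d + 2 - s + 1\<close> is
      1.\<close>
    using prob_no_legal_system_le[of n m 2 0] n m by simp
  also have "\<dots> \<le> real n * (2 * real n powr (2/5) / real n) ^ 2"
    using N by (intro mult_left_mono power_mono divide_right_mono) auto
  also have "\<dots> = 4 * real n powr (-1/5)"
  proof -
    have "real n powr (2/5) * real n powr (2/5) = real n powr (-1/5) * real n"
      using n by (simp add: powr_add[symmetric] powr_mult_base mult.commute[of _ "real n"])
    then show ?thesis
      using n by (simp add: power2_eq_square field_simps)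
  qed
  finally show ?thesis .
qed

lemma prob_no_legal_system_dense:
  assumes n: "3 \<le> n" and m: "m \<le> n choose 2" and N4: "4 \<le> (n choose 2) - m"
    and N: "real n powr (2/5) \<le> real ((n choose 2) - m)"
    and m98: "0.98 * real (n choose 2) \<le> real m"
  shows "measure_pmf.prob (random_graph n m) {E. \<not> has_legal_system {..<n} E}
    \<le> real n * 0.8 powr (real n powr (1/5) / 4 - 1/2)"
proof -
  define N where "N = real ((n choose 2) - m)"
  \<comment> \<open>The largest \<open>d\<close> with \<open>2 * (d + 1) \<le> sqrt N\<close>, which
    yields \<open>4 * d * (d + 1) < N\<close>. The subtraction is not truncated because
    \<open>N4\<close> gives \<open>2 \<le> sqrt N\<close>.\<close>
  define d where "d = nat \<lfloor>sqrt N / 2\<rfloor> - 1"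
  define s where "s = (d + 2) div 2"
  have sqrt2: "2 \<le> sqrt N"
    using N4 by (intro real_le_rsqrt) (simp add: N_def)
  then have "1 \<le> nat \<lfloor>sqrt N / 2\<rfloor>"
    by linarith
  then have d: "real d + 1 = of_int \<lfloor>sqrt N / 2\<rfloor>"
    using sqrt2 by (simp add: d_def of_nat_diff)
  then have d1: "real d + 1 \<le> sqrt N / 2" and d2: "sqrt N / 2 < real d + 2"
    by linarith+
  have N0: "0 < N"
    using N4 by (simp add: N_def)
  \<comment> \<open>The only use of the constant 0.98: it gives \<open>sqrt N \<le> n / 10\<close>,
    which turns the later base \<open>8 * sqrt N / n\<close> into at most 0.8.\<close>
  have "N \<le> 0.02 * real (n choose 2)"
    using m m98 by (simp add: N_def of_nat_diff)
  also have "\<dots> \<le> (real n / 10)\<^sup>2"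
    using n by (simp add: choose_two real_of_nat_div of_nat_diff power2_eq_square field_simps)
  finally have sqrtn: "sqrt N \<le> real n / 10"
    by (intro real_le_lsqrt) (use N0 in auto)
  have "real (4 * d * (d + 1)) = (4 * real d) * (real d + 1)"
    by (simp add: algebra_simps)
  also have "\<dots> < (4 * (real d + 1)) * (real d + 1)"
    by (intro mult_strict_right_mono) auto
  also have "\<dots> = 4 * (real d + 1)\<^sup>2"
    by (simp add: power2_eq_square)
  also have "\<dots> \<le> 4 * (sqrt N / 2)\<^sup>2"
    using d1 by (intro mult_left_mono power_mono) auto
  also have "\<dots> = N"
    using N0 by (simp add: power_divide)
  finally have dN: "4 * d * (d + 1) < (n choose 2) - m"
    by (simp only: N_def of_nat_less_iff)
  have s1: "real s \<ge> (real d + 1) / 2" and s2: "real s \<le> (real d + 2) / 2"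
  proof -
    have "d + 1 \<le> 2 * s" "2 * s \<le> d + 2"
      unfolding s_def by presburger+
    then have "real (d + 1) \<le> real (2 * s)" "real (2 * s) \<le> real (d + 2)"
      by (simp_all only: of_nat_le_iff)
    then show "real s \<ge> (real d + 1) / 2" "real s \<le> (real d + 2) / 2"
      by simp_all
  qed
  have "real s < real n"
    using s2 d1 sqrtn n by simp
  then have "s < n"
    by simp
  \<comment> \<open>Taking \<open>s\<close> near half of the threshold \<open>d + 2\<close> makes the base of the power at most \<open>4/5\<close>.\<close>
  have "2 * N / real n / (real (d + 2) - real s + 1) \<le> 2 * N / real n / (sqrt N / 4)"
    using s2 d2 sqrt2 n N0 by (intro divide_left_mono mult_pos_pos) auto
  also have "\<dots> = 8 * (N / sqrt N) / real n"
    by (simp add: field_simps)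
  also have "\<dots> = 8 * sqrt N / real n"
    using N0 by (simp add: real_div_sqrt)
  also have "\<dots> \<le> 0.8"
    using sqrtn n by (simp add: field_simps)
  finally have q: "2 * N / real n / (real (d + 2) - real s + 1) \<le> 0.8" .
  \<comment> \<open>From \<open>s1\<close> and \<open>d2\<close>, \<open>s\<close> is at least
    \<open>sqrt N / 4 - 1/2\<close>, and \<open>sqrt N\<close> is at least
    \<open>n powr (1/5)\<close>. So the exponent grows like a power of \<open>n\<close>, and the
    exponential decay beats the factor \<open>n\<close> of the union bound.\<close>
  have s4: "real n powr (1/5) / 4 - 1/2 \<le> real s"
  proof -
    have "(real n powr (1/5))\<^sup>2 = real n powr (2/5)"
      by (simp add: power2_eq_square powr_add[symmetric])
    then have "real n powr (1/5) \<le> sqrt N"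
      using N by (intro real_le_rsqrt) (simp add: N_def)
    then show ?thesis
      using s1 d2 by (simp add: field_simps)
  qed
  have "measure_pmf.prob (random_graph n m) {E. \<not> has_legal_system {..<n} E}
      \<le> real n * (2 * N / real n / (real (d + 2) - real s + 1)) ^ s"
    unfolding N_def using n m dN \<open>s < n\<close> by (intro prob_no_legal_system_le) (auto simp: s_def)
  also have "\<dots> \<le> real n * 0.8 ^ s"
    using q s2 N0 by (intro mult_left_mono power_mono divide_nonneg_nonneg) auto
  also have "\<dots> = real n * 0.8 powr real s"
    by (subst powr_realpow) simp_all
  also have "\<dots> \<le> real n * 0.8 powr (real n powr (1/5) / 4 - 1/2)"
    using s4 by (intro mult_left_mono powr_mono') auto
  finally show ?thesis .
qed

theorem theorem3p1:
  fixes m :: "nat \<Rightarrow> nat"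
  assumes "eventually (\<lambda>n. 0.98 * real (n choose 2) \<le> real (m n) \<and> m n < n choose 2) sequentially"
  shows "(\<lambda>n. measure_pmf.prob (random_graph n (m n)) {E. has_legal_system {..<n} E}) \<longlonglongrightarrow> 1"
proof -
  let ?p = "\<lambda>n. measure_pmf.prob (random_graph n (m n)) {E. has_legal_system {..<n} E}"
  \<comment> \<open>The sum of both bounds, since \<open>m n\<close> may switch between the regimes
    infinitely often.\<close>
  let ?b = "\<lambda>n. 4 * real n powr (-1/5) + real n * 0.8 powr (real n powr (1/5) / 4 - 1/2)"
  \<comment> \<open>This ensures at least four nonedges in the dense case.\<close>
  have "\<forall>\<^sub>F n in sequentially. 4 \<le> real n powr (2/5)"
    by real_asymp
  then have lower: "\<forall>\<^sub>F n in sequentially. 1 - ?b n \<le> ?p n"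
    using assms eventually_ge_at_top[of 3]
  proof eventually_elim
    case (elim n)
    let ?q = "measure_pmf.prob (random_graph n (m n)) {E. \<not> has_legal_system {..<n} E}"
    have "?p n = 1 - ?q"
      using measure_pmf.prob_compl[of "{E. \<not> has_legal_system {..<n} E}" "random_graph n (m n)"]
      by (simp add: Compl_eq_Diff_UNIV[symmetric] Collect_neg_eq[symmetric])
    moreover have "?q \<le> ?b n"
    \<comment> \<open>The sparse bound tends to zero for a threshold exponent below 1/2, the dense
      one for any positive exponent; 2/5 satisfies both.\<close>
    proof (cases "real ((n choose 2) - m n) \<le> real n powr (2/5)")
      case True
      then have "?q \<le> 4 * real n powr (-1/5)"
        using elim by (intro prob_no_legal_system_sparse) auto
      also have "\<dots> \<le> ?b n"
        by simp
      finally show ?thesis .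
    next
      case False
      then have "4 \<le> (n choose 2) - m n"
        using elim by linarith
      then have "?q \<le> real n * 0.8 powr (real n powr (1/5) / 4 - 1/2)"
        using elim False by (intro prob_no_legal_system_dense) auto
      also have "\<dots> \<le> ?b n"
        by simp
      finally show ?thesis .
    qed
    ultimately show ?case
      by simp
  qed
  have lim: "(\<lambda>n. 1 - ?b n) \<longlonglongrightarrow> 1"
    by real_asymp
  show ?thesis
    by (rule tendsto_sandwich[OF lower _ lim tendsto_const]) simp
qed

end
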